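(* Let $n\ge 2$ and let $\mu$ be a positive Borel measure on an open set $G\subset\mathbb{R}^n$ such that $\mu(G)<\infty$. Let $0<\delta<1$, $0<\tau\le\infty$, and $0<p\le q<\infty$. Then the following conditions are equivalent (with the understanding that $B(y,\tau\,\mathrm{dist}(y,\partial G)):=\mathbb{R}^n$ whenever $y\in G$ and $\tau=\infty$): (A) There is a constant $C_1>0$ such that the inequality $$\inf_{a\in\mathbb{R}}\sup_{t>0}\mu(\{x\in G:\ |u(x)-a|>t\})\,t^q\le C_1\biggl(\int_G\int_{G\cap B(y,\tau\,\mathrm{dist}(y,\partial G))}\frac{|u(y)-u(z)|^p}{|y-z|^{n+\delta p}}\,d\mu(z)\,d\mu(y)\biggr)^{q/p}$$ holds for every $u\in L^\infty(G;\mu)$. (B) There is a constant $C_2>0$ such that the inequality $$\inf_{a\in\mathbb{R}}\int_G|u(x)-a|^q\,d\mu(x)\le C_2\biggl(\int_G\int_{G\cap B(y,\tau\,\mathrm{dist}(y,\partial G))}\frac{|u(y)-u(z)|^p}{|y-z|^{n+\delta p}}\,d\mu(z)\,d\mu(y)\biggr)^{q/p}$$ holds for every $u\in L^1(G;\mu)$. Moreover, in the implication from (A) to (B) the constant $C_2$ is of the form $C(p,q)\,C_1$, where $C(p,q)>0$ depends only on $p$ and $q$; in the converse implication one may take $C_1=C_2$.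
   Context: $\mathrm{dist}(y,\partial G)$ is the distance from $y$ to the boundary of $G$ (understood as $+\infty$ if $\partial G=\emptyset$), and $B(y,r)$ is the ball of center $y$ and radius $r$ (all of $\mathbb{R}^n$ if $r=\infty$). Functions are real-valued. The integrals take values in $[0,\infty]$. The integrand $|u(y)-u(z)|^p/|y-z|^{n+\delta p}$ is understood to be $0$ when $y=z$. *)

theory Defs
  imports "HOL-Analysis.Analysis"
begin

text \<open>
  The dimension \<open>n\<close> has to be quantified inside the statement, since one constant serves all
  dimensions. Hence \<open>\<real>\<^sup>n\<close> is the library topology \<^term>\<open>Euclidean_space n\<close>, whose points are the
  functions \<^typ>\<open>nat \<Rightarrow> real\<close> vanishing at every index \<open>i \<ge> n\<close>.
\<close>

definition eucl_dist :: "nat \<Rightarrow> (nat \<Rightarrow> real) \<Rightarrow> (nat \<Rightarrow> real) \<Rightarrow> real" where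
  "eucl_dist n x y = L2_set (\<lambda>i. x i - y i) {..<n}"

definition eucl_ball :: "nat \<Rightarrow> (nat \<Rightarrow> real) \<Rightarrow> ennreal \<Rightarrow> (nat \<Rightarrow> real) set" where
  "eucl_ball n y r = {z \<in> topspace (Euclidean_space n). ennreal (eucl_dist n y z) < r}"

text \<open>In \<^typ>\<open>ennreal\<close> the infimum over an empty boundary is \<open>\<infinity>\<close>.\<close>

definition bdry_dist :: "nat \<Rightarrow> (nat \<Rightarrow> real) set \<Rightarrow> (nat \<Rightarrow> real) \<Rightarrow> ennreal" where
  "bdry_dist n G y = (INF x \<in> Euclidean_space n frontier_of G. ennreal (eucl_dist n y x))"

definition tau_ball ::
  "nat \<Rightarrow> (nat \<Rightarrow> real) set \<Rightarrow> ennreal \<Rightarrow> (nat \<Rightarrow> real) \<Rightarrow> (nat \<Rightarrow> real) set" where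
  "tau_ball n G \<tau> y =
     (if \<tau> = \<infinity> then topspace (Euclidean_space n) else eucl_ball n y (\<tau> * bdry_dist n G y))"

text \<open>
  The type \<^typ>\<open>nat \<Rightarrow> real\<close> carries the product topology, of which \<^term>\<open>Euclidean_space n\<close> is a
  subspace; so the trace of \<^term>\<open>borel\<close> on \<open>G\<close> is the Borel \<open>\<sigma>\<close>-algebra of \<open>G \<subseteq> \<real>\<^sup>n\<close>.
  The equation of \<open>\<sigma>\<close>-algebras includes \<^term>\<open>space \<mu> = G\<close>.
\<close>

definition borel_measure_on :: "(nat \<Rightarrow> real) set \<Rightarrow> (nat \<Rightarrow> real) measure \<Rightarrow> bool" where
  "borel_measure_on G \<mu> \<longleftrightarrow> sets \<mu> = sets (restrict_space borel G)"

definition L_infinity :: "'a measure \<Rightarrow> ('a \<Rightarrow> real) set" where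
  "L_infinity \<mu> = {u \<in> borel_measurable \<mu>. \<exists>M. AE x in \<mu>. \<bar>u x\<bar> \<le> M}"

text \<open>Meant for exponents \<open>r > 0\<close>, where \<open>\<infinity>\<^sup>r = \<infinity>\<close>.\<close>

definition ennpowr :: "ennreal \<Rightarrow> real \<Rightarrow> ennreal" where
  "ennpowr x r = (if x = \<infinity> then \<infinity> else ennreal (enn2real x powr r))"

definition frac_energy ::
  "nat \<Rightarrow> (nat \<Rightarrow> real) set \<Rightarrow> (nat \<Rightarrow> real) measure \<Rightarrow> real \<Rightarrow> ennreal \<Rightarrow> real \<Rightarrow>
   ((nat \<Rightarrow> real) \<Rightarrow> real) \<Rightarrow> ennreal" where
  "frac_energy n G \<mu> \<delta> \<tau> p u =
     (\<integral>\<^sup>+y\<in>G. (\<integral>\<^sup>+z\<in>G \<inter> tau_ball n G \<tau> y.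
        ennreal (if y = z then 0
                 else \<bar>u y - u z\<bar> powr p / eucl_dist n y z powr (real n + \<delta> * p)) \<partial>\<mu>) \<partial>\<mu>)"

definition weak_ineq ::
  "nat \<Rightarrow> (nat \<Rightarrow> real) set \<Rightarrow> (nat \<Rightarrow> real) measure \<Rightarrow> real \<Rightarrow> ennreal \<Rightarrow> real \<Rightarrow> real \<Rightarrow>
   real \<Rightarrow> bool" where
  "weak_ineq n G \<mu> \<delta> \<tau> p q C \<longleftrightarrow>
     (\<forall>u \<in> L_infinity \<mu>.
        (INF a::real. SUP t\<in>{0<..}. emeasure \<mu> {x \<in> G. \<bar>u x - a\<bar> > t} * ennreal (t powr q))
        \<le> ennreal C * ennpowr (frac_energy n G \<mu> \<delta> \<tau> p u) (q / p))"

definition strong_ineq ::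
  "nat \<Rightarrow> (nat \<Rightarrow> real) set \<Rightarrow> (nat \<Rightarrow> real) measure \<Rightarrow> real \<Rightarrow> ennreal \<Rightarrow> real \<Rightarrow> real \<Rightarrow>
   real \<Rightarrow> bool" where
  "strong_ineq n G \<mu> \<delta> \<tau> p q C \<longleftrightarrow>
     (\<forall>u. integrable \<mu> u \<longrightarrow>
        (INF a::real. \<integral>\<^sup>+x\<in>G. ennreal (\<bar>u x - a\<bar> powr q) \<partial>\<mu>)
        \<le> ennreal C * ennpowr (frac_energy n G \<mu> \<delta> \<tau> p u) (q / p))"

end

theory Submission
  imports Defs "HOL-Probability.Distribution_Functions"
begin

text \<open>
  The strong inequality implies the weak one with the same constant, by Chebyshev's inequality: the
  energies on the two right-hand sides agree, and bounded functions are integrable because the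
  measure is finite.

  The converse is Maz'ya's truncation argument. Subtract a median \<open>b\<close> of \<open>u\<close> and let \<open>v\<close> be \<open>u - b\<close>
  or \<open>b - u\<close>; then \<open>v \<le> 0\<close> on at least half of the space. For each integer \<open>k\<close> the truncation
  \<open>w\<^sub>k = min (2\<^sup>k) (max 0 (v - 2\<^sup>k))\<close> is bounded, so the weak inequality applies to it. As \<open>w\<^sub>k\<close>
  vanishes on half of the space, no constant \<open>a\<close> can be close to \<open>w\<^sub>k\<close> both there and on the set
  \<open>{v \<ge> 2\<^sup>k\<^sup>+\<^sup>1}\<close>, where \<open>w\<^sub>k = 2\<^sup>k\<close>. So the weak norm of \<open>w\<^sub>k - a\<close> controls
  \<open>\<mu>{v \<ge> 2\<^sup>k\<^sup>+\<^sup>1} 2\<^sup>k\<^sup>q\<close> for every \<open>a\<close> (\<open>level_set_le_weak_power\<close>). Summed over \<open>k\<close>, the left-hand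
  sides dominate the integral of the \<open>q\<close>-th power of the positive part of \<open>v\<close>
  (\<open>nn_integral_powr_le_of_layers\<close>). On the right, \<open>q/p \<ge> 1\<close> moves the sum inside the power
  (\<open>sum_ennpowr_le\<close>), and the energies of the truncations add up to at most a constant times the
  energy of \<open>u\<close>. The last point is the pointwise bound
  \<open>\<Sum>\<^sub>k \<bar>w\<^sub>k(y) - w\<^sub>k(z)\<bar>\<^sup>p \<le> c(p) \<bar>v(y) - v(z)\<bar>\<^sup>p\<close> (\<open>sum_dyadic_trunc_le\<close>). Since \<open>p < 1\<close> is allowed,
  it cannot be obtained by simply adding the increments: it uses that the truncation levels are
  geometrically spaced.

  The kernel \<open>\<bar>y - z\<bar>\<^sup>-\<^sup>n\<^sup>-\<^sup>\<delta>\<^sup>p\<close> and the domain of integration enter these estimates only as a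
  nonnegative weight. Hence the constant depends on \<open>p\<close> and \<open>q\<close> alone, and the argument is carried out
  for an arbitrary kernel \<open>\<kappa>\<close> on a finite measure space.
\<close>

section \<open>Integrals of functions that need not be measurable\<close>

text \<open>
  The integral is a supremum over simple minorants. For functions that are not assumed measurable it
  is therefore still superadditive, though not additive in general. Sums of energies have to be bounded from
  above by one energy, which is this direction; so it suffices for arbitrary kernels.
\<close>

lemma nn_integral_superadditive:
  "(\<integral>\<^sup>+x. f x \<partial>M) + (\<integral>\<^sup>+x. g x \<partial>M) \<le> (\<integral>\<^sup>+x. f x + g x \<partial>M)"
proof -
  let ?S = "\<lambda>f. {s. simple_function M s \<and> s \<le> f}"
  have ne: "?S f \<noteq> {}" for f :: "'a \<Rightarrow> ennreal"
    by (auto intro!: exI[of _ "\<lambda>_. 0"] simp: le_fun_def)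
  have simple: "integral\<^sup>S M s + integral\<^sup>S M r \<le> (\<integral>\<^sup>+x. f x + g x \<partial>M)"
    if "s \<in> ?S f" "r \<in> ?S g" for s r
  proof -
    have "integral\<^sup>S M s + integral\<^sup>S M r = (\<integral>\<^sup>+x. s x \<partial>M) + (\<integral>\<^sup>+x. r x \<partial>M)"
      using that by (simp add: nn_integral_eq_simple_integral)
    also have "\<dots> = (\<integral>\<^sup>+x. s x + r x \<partial>M)"
      using that by (intro nn_integral_add[symmetric]) (auto dest: borel_measurable_simple_function)
    also have "\<dots> \<le> (\<integral>\<^sup>+x. f x + g x \<partial>M)"
      using that by (intro nn_integral_mono add_mono) (auto simp: le_fun_def)
    finally show ?thesis .
  qed
  have "integral\<^sup>S M s + (\<integral>\<^sup>+x. g x \<partial>M) \<le> (\<integral>\<^sup>+x. f x + g x \<partial>M)" if "s \<in> ?S f" for s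
    unfolding nn_integral_def[of M g] ennreal_SUP_add_right[OF ne]
    by (intro SUP_least simple that)
  then show ?thesis
    unfolding nn_integral_def[of M f] ennreal_SUP_add_left[OF ne, symmetric]
    by (meson SUP_least)
qed

lemma nn_integral_sum_superadditive:
  "finite A \<Longrightarrow> (\<Sum>i\<in>A. \<integral>\<^sup>+x. f i x \<partial>M) \<le> (\<integral>\<^sup>+x. (\<Sum>i\<in>A. f i x) \<partial>M)"
proof (induction A rule: finite_induct)
  case (insert i A)
  then have "(\<Sum>i\<in>insert i A. \<integral>\<^sup>+x. f i x \<partial>M)
      \<le> (\<integral>\<^sup>+x. f i x \<partial>M) + (\<integral>\<^sup>+x. (\<Sum>i\<in>A. f i x) \<partial>M)"
    by (simp add: add_left_mono)
  also have "\<dots> \<le> (\<integral>\<^sup>+x. (\<Sum>i\<in>insert i A. f i x) \<partial>M)"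
    using nn_integral_superadditive[of M "f i"] insert by simp
  finally show ?case .
qed simp

lemma ennreal_cancel_left_le_iff:
  fixes c :: real
  assumes "0 < c"
  shows "ennreal (1 / c) * x \<le> y \<longleftrightarrow> x \<le> ennreal c * y"
proof -
  have inv: "ennreal c * ennreal (1 / c) = 1"
    using assms by (simp flip: ennreal_mult)
  show ?thesis
    using mult_left_mono[of "ennreal (1 / c) * x" y "ennreal c"]
      mult_left_mono[of x "ennreal c * y" "ennreal (1 / c)"] inv
    by (auto simp: mult.assoc[symmetric] mult.commute[of "ennreal (1 / c)" "ennreal c"])
qed

lemma nn_integral_cmult_le:
  fixes c :: real
  assumes "0 < c"
  shows "(\<integral>\<^sup>+x. ennreal c * f x \<partial>M) \<le> ennreal c * (\<integral>\<^sup>+x. f x \<partial>M)"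
  unfolding nn_integral_def[of M "\<lambda>x. ennreal c * f x"]
proof (intro SUP_least)
  fix s assume "s \<in> {s. simple_function M s \<and> s \<le> (\<lambda>x. ennreal c * f x)}"
  then have s: "simple_function M s" and le: "s x \<le> ennreal c * f x" for x
    by (auto simp: le_fun_def)
  have [measurable]: "s \<in> borel_measurable M"
    using s by (rule borel_measurable_simple_function)
  have "ennreal (1 / c) * integral\<^sup>S M s = (\<integral>\<^sup>+x. ennreal (1 / c) * s x \<partial>M)"
    using s by (simp add: nn_integral_cmult nn_integral_eq_simple_integral)
  also have "\<dots> \<le> (\<integral>\<^sup>+x. f x \<partial>M)"
    using le by (intro nn_integral_mono) (simp add: ennreal_cancel_left_le_iff[OF assms])
  finally show "integral\<^sup>S M s \<le> ennreal c * (\<integral>\<^sup>+x. f x \<partial>M)"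
    by (simp add: ennreal_cancel_left_le_iff[OF assms])
qed

lemma nn_integral_sum_le_cmult:
  fixes c :: real
  assumes "finite A" "0 < c"
    and "\<And>x. x \<in> space M \<Longrightarrow> (\<Sum>i\<in>A. f i x) \<le> ennreal c * g x"
  shows "(\<Sum>i\<in>A. \<integral>\<^sup>+x. f i x \<partial>M) \<le> ennreal c * (\<integral>\<^sup>+x. g x \<partial>M)"
proof -
  have "(\<Sum>i\<in>A. \<integral>\<^sup>+x. f i x \<partial>M) \<le> (\<integral>\<^sup>+x. (\<Sum>i\<in>A. f i x) \<partial>M)"
    using assms(1) by (rule nn_integral_sum_superadditive)
  also have "\<dots> \<le> (\<integral>\<^sup>+x. ennreal c * g x \<partial>M)"
    by (rule nn_integral_mono) (rule assms(3))
  also have "\<dots> \<le> ennreal c * (\<integral>\<^sup>+x. g x \<partial>M)"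
    using assms(2) by (rule nn_integral_cmult_le)
  finally show ?thesis .
qed

section \<open>Energies with an arbitrary kernel\<close>

text \<open>
  The ball over which the inner integral of the fractional energy extends depends on \<open>y\<close>; its
  indicator function can be absorbed into \<open>\<kappa>\<close>.
\<close>

definition kernel_energy ::
  "'a measure \<Rightarrow> ('a \<Rightarrow> 'a \<Rightarrow> ennreal) \<Rightarrow> real \<Rightarrow> ('a \<Rightarrow> real) \<Rightarrow> ennreal" where
  "kernel_energy M \<kappa> p u = (\<integral>\<^sup>+y. \<integral>\<^sup>+z. \<kappa> y z * ennreal (\<bar>u y - u z\<bar> powr p) \<partial>M \<partial>M)"

lemma sum_kernel_energy_le:
  fixes c :: real
  assumes "finite A" "0 < c"
    and "\<And>y z. (\<Sum>i\<in>A. \<bar>w i y - w i z\<bar> powr p) \<le> c * \<bar>u y - u z\<bar> powr p"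
  shows "(\<Sum>i\<in>A. kernel_energy M \<kappa> p (w i)) \<le> ennreal c * kernel_energy M \<kappa> p u"
  unfolding kernel_energy_def
proof (intro nn_integral_sum_le_cmult assms(1,2))
  fix y z
  have "(\<Sum>i\<in>A. \<kappa> y z * ennreal (\<bar>w i y - w i z\<bar> powr p))
      = \<kappa> y z * ennreal (\<Sum>i\<in>A. \<bar>w i y - w i z\<bar> powr p)"
    by (simp add: sum_distrib_left[symmetric] sum_ennreal)
  also have "\<dots> \<le> \<kappa> y z * ennreal (c * \<bar>u y - u z\<bar> powr p)"
    by (intro mult_left_mono ennreal_leI assms(3)) simp
  also have "\<dots> = ennreal c * (\<kappa> y z * ennreal (\<bar>u y - u z\<bar> powr p))"
    using assms(2) by (simp add: ennreal_mult mult.left_commute)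
  finally show "(\<Sum>i\<in>A. \<kappa> y z * ennreal (\<bar>w i y - w i z\<bar> powr p))
      \<le> ennreal c * (\<kappa> y z * ennreal (\<bar>u y - u z\<bar> powr p))" .
qed

lemma frac_energy_eq_kernel_energy:
  assumes "space \<mu> = G"
  shows "frac_energy n G \<mu> \<delta> \<tau> p u = kernel_energy \<mu> (\<lambda>y z.
    ennreal (if y = z then 0 else 1 / eucl_dist n y z powr (real n + \<delta> * p))
      * indicator (G \<inter> tau_ball n G \<tau> y) z) p u"
  unfolding frac_energy_def kernel_energy_def
proof (rule nn_integral_cong, goal_cases)
  case (1 y)
  have "ennreal (if y = z then 0 else \<bar>u y - u z\<bar> powr p / eucl_dist n y z powr (real n + \<delta> * p))
          * indicator (G \<inter> tau_ball n G \<tau> y) z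
      = ennreal (if y = z then 0 else 1 / eucl_dist n y z powr (real n + \<delta> * p))
          * indicator (G \<inter> tau_ball n G \<tau> y) z * ennreal (\<bar>u y - u z\<bar> powr p)" for z
    by (auto simp: indicator_def simp flip: ennreal_mult)
  then show ?case
    using 1 assms by simp
qed

section \<open>Powers of extended nonnegative numbers\<close>

lemma powr_superadditive:
  fixes a b r :: real
  assumes "0 \<le> a" "0 \<le> b" "1 \<le> r"
  shows "a powr r + b powr r \<le> (a + b) powr r"
proof -
  have split: "x powr r = x * x powr (r - 1)" if "0 \<le> x" for x :: real
    using that by (cases "x = 0") (auto simp: powr_diff)
  have "a powr r + b powr r \<le> a * (a + b) powr (r - 1) + b * (a + b) powr (r - 1)"
    unfolding split[OF assms(1)] split[OF assms(2)]
    using assms by (intro add_mono mult_left_mono powr_mono2) auto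
  also have "\<dots> = (a + b) powr r"
    using assms by (subst split[of "a + b"]) (auto simp: algebra_simps)
  finally show ?thesis .
qed

lemma ennpowr_ennreal: "0 \<le> a \<Longrightarrow> ennpowr (ennreal a) r = ennreal (a powr r)"
  by (simp add: ennpowr_def)

lemma ennpowr_top [simp]: "ennpowr top r = top"
  by (simp add: ennpowr_def infinity_ennreal_def)

lemma ennpowr_mono:
  assumes "x \<le> y" "0 \<le> r"
  shows "ennpowr x r \<le> ennpowr y r"
proof (cases y)
  case (real b)
  with assms(1) obtain a where "x = ennreal a" "0 \<le> a"
    by (cases x) (auto simp: top_unique)
  with real assms show ?thesis
    by (auto simp: ennpowr_ennreal intro!: ennreal_leI powr_mono2)
qed simp

lemma ennpowr_superadditive:
  assumes "1 \<le> r"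
  shows "ennpowr x r + ennpowr y r \<le> ennpowr (x + y) r"
proof (cases x; cases y)
  fix a b assume "0 \<le> a" "x = ennreal a" "0 \<le> b" "y = ennreal b"
  then show ?thesis
    using powr_superadditive[of a b r] assms
    by (simp add: ennpowr_ennreal flip: ennreal_plus)
qed simp_all

lemma sum_ennpowr_le:
  assumes "finite A" "1 \<le> r"
  shows "(\<Sum>i\<in>A. ennpowr (x i) r) \<le> ennpowr (\<Sum>i\<in>A. x i) r"
  using assms(1)
proof (induction A rule: finite_induct)
  case (insert i A)
  then have "(\<Sum>i\<in>insert i A. ennpowr (x i) r) \<le> ennpowr (x i) r + ennpowr (\<Sum>i\<in>A. x i) r"
    by (simp add: add_left_mono)
  also have "\<dots> \<le> ennpowr (\<Sum>i\<in>insert i A. x i) r"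
    using insert ennpowr_superadditive[OF assms(2)] by simp
  finally show ?case .
qed simp

lemma ennpowr_cmult:
  assumes "0 < c"
  shows "ennpowr (ennreal c * x) r = ennreal (c powr r) * ennpowr x r"
proof (cases x)
  case (real a)
  then show ?thesis
    using assms by (simp add: ennpowr_ennreal powr_mult flip: ennreal_mult)
next
  case top
  then show ?thesis
    using assms by (simp add: ennreal_mult_top)
qed

section \<open>Dyadic truncations\<close>

text \<open>
  This function of \<open>s\<close> is flat outside \<open>[2\<^sup>k, 2\<^sup>k\<^sup>+\<^sup>1]\<close> and has slope \<open>1\<close> inside. It vanishes for
  negative \<open>s\<close>, so that truncating \<open>v\<close> and truncating its positive part is the same thing.
\<close>

definition dyadic_trunc :: "int \<Rightarrow> real \<Rightarrow> real" where
  "dyadic_trunc k s = min (2 powr k) (max 0 (s - 2 powr k))"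

text \<open>
  The first summand is a geometric series, coming from the levels below \<open>\<bar>s - t\<bar>\<close>; the second counts
  the larger levels that can separate \<open>s\<close> from \<open>t\<close>.
\<close>

definition dyadic_const :: "real \<Rightarrow> real" where
  "dyadic_const p = 1 / (1 - 2 powr (- p)) + 2"

lemma dyadic_const_pos: "0 < p \<Longrightarrow> 0 < dyadic_const p"
  by (auto simp: dyadic_const_def powr_minus intro!: add_nonneg_pos divide_nonneg_nonneg)
     (simp add: inverse_le_1_iff ge_one_powr_ge_zero)

lemma sum_powr_two_le:
  fixes A :: "int set" and m :: int
  assumes "0 < p" "finite A" "\<And>k. k \<in> A \<Longrightarrow> k \<le> m"
  shows "(\<Sum>k\<in>A. (2 powr real_of_int k) powr p) \<le> (2 powr m) powr p / (1 - 2 powr (- p))"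
proof -
  let ?x = "2 powr (- p) :: real"
  have x: "norm ?x < 1"
    using powr_less_one[of 2 "- p"] assms(1) by simp
  have summand: "(2 powr real_of_int k) powr p = (2 powr m) powr p * ?x ^ nat (m - k)" if "k \<in> A" for k
  proof -
    have "?x ^ nat (m - k) = 2 powr (- p * (m - k))"
      using assms(3)[OF that] by (simp add: powr_realpow[symmetric] powr_powr)
    then show ?thesis
      by (simp add: powr_powr powr_add[symmetric] algebra_simps)
  qed
  have "(\<Sum>k\<in>A. (2 powr real_of_int k) powr p) = (2 powr m) powr p * (\<Sum>k\<in>A. ?x ^ nat (m - k))"
    unfolding sum_distrib_left by (rule sum.cong[OF refl]) (rule summand)
  also have "(\<Sum>k\<in>A. ?x ^ nat (m - k)) = (\<Sum>j\<in>(\<lambda>k. nat (m - k)) ` A. ?x ^ j)"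
  proof (subst sum.reindex)
    show "inj_on (\<lambda>k. nat (m - k)) A"
    proof (rule inj_onI)
      fix k l assume "k \<in> A" "l \<in> A" "nat (m - k) = nat (m - l)"
      then show "k = l"
        using assms(3)[of k] assms(3)[of l] by simp
    qed
  qed simp
  also have "\<dots> \<le> (\<Sum>j. ?x ^ j)"
    using x assms(2) by (intro sum_le_suminf summable_geometric) auto
  also have "\<dots> = 1 / (1 - ?x)"
    using x by (rule suminf_geometric)
  finally show ?thesis
    by (simp add: mult_left_mono)
qed

text \<open>
  Let \<open>d = t - s\<close>. A truncation changes by at most \<open>min d (2\<^sup>k)\<close> between \<open>s\<close> and \<open>t\<close>. The levels with
  \<open>2\<^sup>k \<le> d\<close> contribute a geometric series dominated by its largest term. If \<open>2\<^sup>k > d\<close>, the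
  truncation only changes if \<open>[s, t]\<close> meets the interior of \<open>[2\<^sup>k, 2\<^sup>k\<^sup>+\<^sup>1]\<close>, and an interval of
  length \<open>d\<close> is too short to meet more than two such intervals: it would have to cover the one in the
  middle.
\<close>

lemma sum_dyadic_trunc_le_ordered:
  assumes p: "0 < p" and A: "finite A" and st: "s < t"
  shows "(\<Sum>k\<in>A. \<bar>dyadic_trunc k s - dyadic_trunc k t\<bar> powr p) \<le> dyadic_const p * (t - s) powr p"
proof -
  define d where "d = t - s"
  define m where "m = \<lfloor>log 2 d\<rfloor>"
  define f where "f k = \<bar>dyadic_trunc k s - dyadic_trunc k t\<bar>" for k
  define B where "B = {k \<in> A. m < k \<and> f k \<noteq> 0}"
  have d: "0 < d"
    using st by (simp add: d_def)
  have m: "2 powr m \<le> d"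
    using d by (simp add: m_def powr_le_iff)
  have large: "d < 2 powr k" if "m < k" for k :: int
  proof -
    have "log 2 d < k"
      using that by (simp add: m_def floor_less_iff)
    then show ?thesis
      using d by (simp add: log_less_iff)
  qed
  have f_le: "f k \<le> d" "f k \<le> 2 powr k" for k
    using st by (auto simp: f_def d_def dyadic_trunc_def min_def max_def abs_if)
  have f_ne: "s < 2 powr (k + 1) \<and> 2 powr k < t" if "f k \<noteq> 0" for k :: int
  proof -
    define h :: real where "h = 2 powr k"
    have "0 < h" "2 powr (k + 1) = 2 * h"
      by (simp_all add: h_def powr_add)
    moreover have "min h (max 0 (s - h)) \<noteq> min h (max 0 (t - h))"
      using that by (simp add: f_def dyadic_trunc_def h_def)
    ultimately show ?thesis
      using st unfolding h_def[symmetric] by linarith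
  qed
  have near: "l \<le> k + 1" if "k \<in> B" "l \<in> B" for k l
  proof (rule ccontr)
    assume "\<not> l \<le> k + 1"
    then have "(2::real) powr (real_of_int k + 2) \<le> 2 powr l"
      by (intro powr_mono) auto
    moreover have "s < 2 powr (k + 1)" "2 powr l < t" "d < 2 powr k"
      using that f_ne large by (auto simp: B_def)
    moreover have "(0::real) < 2 powr k"
      by simp
    ultimately show False
      by (simp add: d_def powr_add)
  qed
  have cardB: "card B \<le> 2"
  proof (cases "B = {}")
    case False
    have fin: "finite B"
      using A by (simp add: B_def)
    have "B \<subseteq> {Min B, Min B + 1}"
    proof
      fix l assume "l \<in> B"
      then have "Min B \<le> l" "l \<le> Min B + 1"
        using near[OF Min_in[OF fin False]] fin by auto
      then show "l \<in> {Min B, Min B + 1}"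
        by auto
    qed
    then have "card B \<le> card {Min B, Min B + 1}"
      by (intro card_mono) auto
    then show ?thesis
      by simp
  qed simp
  have "(\<Sum>k\<in>A. f k powr p) = (\<Sum>k\<in>{k\<in>A. k \<le> m}. f k powr p) + (\<Sum>k\<in>{k\<in>A. m < k}. f k powr p)"
    using A by (subst sum.union_disjoint[symmetric]) (auto intro!: sum.cong)
  also have "(\<Sum>k\<in>{k\<in>A. m < k}. f k powr p) = (\<Sum>k\<in>B. f k powr p)"
    using A by (intro sum.mono_neutral_right) (auto simp: B_def)
  also have "\<dots> \<le> card B * d powr p"
    using f_le p by (intro sum_bounded_above powr_mono2) (auto simp: f_def)
  also have "\<dots> \<le> 2 * d powr p"
    using cardB by (intro mult_right_mono) auto
  also have "(\<Sum>k\<in>{k\<in>A. k \<le> m}. f k powr p) \<le> (\<Sum>k\<in>{k\<in>A. k \<le> m}. (2 powr k) powr p)"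
    using f_le p by (intro sum_mono powr_mono2) (auto simp: f_def)
  also have "\<dots> \<le> (2 powr m) powr p / (1 - 2 powr (- p))"
    using p A by (intro sum_powr_two_le) auto
  also have "\<dots> \<le> d powr p / (1 - 2 powr (- p))"
    using m p by (intro divide_right_mono powr_mono2) (auto simp: powr_minus inverse_le_1_iff ge_one_powr_ge_zero)
  finally show ?thesis
    by (simp add: f_def d_def dyadic_const_def algebra_simps)
qed

lemma sum_dyadic_trunc_le:
  assumes "0 < p" "finite A"
  shows "(\<Sum>k\<in>A. \<bar>dyadic_trunc k s - dyadic_trunc k t\<bar> powr p) \<le> dyadic_const p * \<bar>s - t\<bar> powr p"
  using sum_dyadic_trunc_le_ordered[OF assms, of s t] sum_dyadic_trunc_le_ordered[OF assms, of t s]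
  by (cases s t rule: linorder_cases) (simp_all add: abs_minus_commute)

section \<open>Medians and weak norms\<close>

text \<open>
  The median is the infimum of the \<open>s\<close> at which the distribution function of \<open>u\<close> is at least half of
  the total mass. Its one-sided limits at that point give the two inequalities.
\<close>

lemma (in finite_measure) median_exists:
  assumes u: "u \<in> borel_measurable M"
  obtains b :: real where
    "measure M (space M) \<le> 2 * measure M {x \<in> space M. u x \<le> b}"
    "measure M (space M) \<le> 2 * measure M {x \<in> space M. b \<le> u x}"
proof (cases "measure M (space M) = 0")
  case True
  then show thesis
    by (intro that[of 0]) auto
next
  case False
  define m where "m = measure M (space M)"
  have m: "0 < m"
    using False by (simp add: m_def zero_less_measure_iff)
  interpret D: finite_borel_measure "distr M borel u"
    using u by (simp add: finite_borel_measure_def finite_borel_measure_axioms_def finite_measure_distr)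
  let ?F = "cdf (distr M borel u)"
  have F: "?F s = measure M {x \<in> space M. u x \<le> s}" for s
    using u by (simp add: cdf_def measure_distr vimage_def Int_def conj_commute)
  have top: "(?F \<longlongrightarrow> m) at_top"
    using D.cdf_lim_at_top u by (simp add: measure_distr m_def)
  define S where "S = {s. m / 2 \<le> ?F s}"
  have "\<forall>\<^sub>F s in at_top. m / 2 < ?F s"
    using order_tendstoD(1)[OF top, of "m / 2"] m by simp
  then have ne: "S \<noteq> {}"
    by (auto simp: S_def eventually_at_top_linorder intro: less_imp_le)
  have "\<forall>\<^sub>F s in at_bot. ?F s < m / 2"
    using order_tendstoD(2)[OF D.cdf_lim_at_bot, of "m / 2"] m by simp
  then obtain L where L: "\<And>s. s \<le> L \<Longrightarrow> ?F s < m / 2"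
    by (auto simp: eventually_at_bot_linorder)
  have bdd: "bdd_below S"
    using L by (intro bdd_belowI[of _ L]) (metis (mono_tags) S_def linorder_le_cases linorder_not_le mem_Collect_eq)
  define b where "b = Inf S"
  have above: "m / 2 \<le> ?F s" if bs: "b < s" for s
  proof -
    obtain r where "r \<in> S" "r < s"
      using bs cInf_lessD[OF ne, of s] by (auto simp: b_def)
    then show ?thesis
      using D.cdf_nondecreasing[of r s] by (auto simp: S_def)
  qed
  have below: "?F s \<le> m / 2" if "s < b" for s
    using that cInf_lower[OF _ bdd, of s] by (force simp: b_def S_def not_le)
  have "m / 2 \<le> ?F b"
    using D.cdf_is_right_cont[of b] above
    by (intro tendsto_lowerbound[of ?F _ "at_right b"])
       (auto simp: continuous_within eventually_at_right_field intro!: exI[of _ "b + 1"])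
  then have 1: "measure M (space M) \<le> 2 * measure M {x \<in> space M. u x \<le> b}"
    by (simp add: F m_def)
  have "measure (distr M borel u) {..<b} \<le> m / 2"
    using D.cdf_at_left[of b] below
    by (intro tendsto_upperbound[of ?F _ "at_left b"])
       (auto simp: eventually_at_left_field intro!: exI[of _ "b - 1"])
  then have "measure M {x \<in> space M. u x < b} \<le> m / 2"
    using u by (simp add: measure_distr vimage_def Int_def conj_commute)
  moreover have "measure M {x \<in> space M. b \<le> u x} = m - measure M {x \<in> space M. u x < b}"
    unfolding m_def using u
    by (subst finite_measure_compl[symmetric]) (auto intro!: arg_cong[where f = "measure M"])
  ultimately have 2: "measure M (space M) \<le> 2 * measure M {x \<in> space M. b \<le> u x}"
    by (simp add: m_def)
  show thesis
    by (rule that[OF 1 2])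
qed

definition weak_power :: "'a measure \<Rightarrow> real \<Rightarrow> ('a \<Rightarrow> real) \<Rightarrow> ennreal" where
  "weak_power M q u = (SUP t\<in>{0<..}. emeasure M {x \<in> space M. \<bar>u x\<bar> > t} * ennreal (t powr q))"

lemma weak_power_le_nn_integral:
  assumes [measurable]: "u \<in> borel_measurable M" and "0 < q"
  shows "weak_power M q u \<le> (\<integral>\<^sup>+x. ennreal (\<bar>u x\<bar> powr q) \<partial>M)"
  unfolding weak_power_def
proof (rule SUP_least)
  fix t :: real assume t: "t \<in> {0<..}"
  have "emeasure M {x \<in> space M. \<bar>u x\<bar> > t} * ennreal (t powr q)
      = (\<integral>\<^sup>+x. ennreal (t powr q) * indicator {x \<in> space M. \<bar>u x\<bar> > t} x \<partial>M)"
    by (simp add: nn_integral_cmult_indicator mult.commute)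
  also have "\<dots> \<le> (\<integral>\<^sup>+x. ennreal (\<bar>u x\<bar> powr q) \<partial>M)"
    using t assms(2)
    by (intro nn_integral_mono) (auto simp: indicator_def intro!: ennreal_leI powr_mono2)
  finally show "emeasure M {x \<in> space M. \<bar>u x\<bar> > t} * ennreal (t powr q)
      \<le> (\<integral>\<^sup>+x. ennreal (\<bar>u x\<bar> powr q) \<partial>M)" .
qed

text \<open>
  If \<open>\<bar>a\<bar> \<ge> h/2\<close>, then \<open>\<bar>w - a\<bar> > h/4\<close> on \<open>{w = 0}\<close>, which carries half of the total mass; otherwise
  \<open>\<bar>w - a\<bar> > h/4\<close> on \<open>{w \<ge> h}\<close>. So \<open>t = h/4\<close> is a good choice in the supremum whatever \<open>a\<close> is, and
  the infimum over \<open>a\<close> can be taken afterwards.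
\<close>

lemma level_set_le_weak_power:
  fixes w :: "'a \<Rightarrow> real"
  assumes [measurable]: "w \<in> borel_measurable M" and h: "0 < h"
    and half: "emeasure M (space M) \<le> 2 * emeasure M {x \<in> space M. w x = 0}"
  shows "emeasure M {x \<in> space M. h \<le> w x} * ennreal (h powr q)
    \<le> ennreal (2 * 4 powr q) * weak_power M q (\<lambda>x. w x - a)"
proof -
  let ?E = "{x \<in> space M. \<bar>w x - a\<bar> > h / 4}"
  have "emeasure M {x \<in> space M. h \<le> w x} \<le> 2 * emeasure M ?E"
  proof (cases "h / 2 \<le> \<bar>a\<bar>")
    case True
    have "emeasure M {x \<in> space M. h \<le> w x} \<le> emeasure M (space M)"
      by (intro emeasure_mono) auto
    also have "\<dots> \<le> 2 * emeasure M {x \<in> space M. w x = 0}"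
      by (rule half)
    also have "\<dots> \<le> 2 * emeasure M ?E"
      using True h by (intro mult_left_mono emeasure_mono) auto
    finally show ?thesis .
  next
    case False
    then have "emeasure M {x \<in> space M. h \<le> w x} \<le> emeasure M ?E"
      using h by (intro emeasure_mono) auto
    also have "\<dots> \<le> 2 * emeasure M ?E"
      by (simp add: mult_2)
    finally show ?thesis .
  qed
  then have "emeasure M {x \<in> space M. h \<le> w x} * ennreal (h powr q)
      \<le> 2 * emeasure M ?E * ennreal (h powr q)"
    by (rule mult_right_mono) simp
  also have "\<dots> = ennreal (2 * 4 powr q) * (emeasure M ?E * ennreal ((h / 4) powr q))"
  proof -
    have "ennreal (h powr q) = ennreal (4 powr q) * ennreal ((h / 4) powr q)"
      using h by (simp add: powr_divide flip: ennreal_mult)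
    then show ?thesis
      by (simp add: ennreal_mult mult_ac)
  qed
  also have "\<dots> \<le> ennreal (2 * 4 powr q) * weak_power M q (\<lambda>x. w x - a)"
    using h unfolding weak_power_def by (intro mult_left_mono SUP_upper) auto
  finally show ?thesis .
qed

section \<open>From the weak to the strong inequality\<close>

text \<open>
  A point with \<open>2\<^sup>k\<^sup>+\<^sup>1 \<le> v < 2\<^sup>k\<^sup>+\<^sup>2\<close> contributes at most \<open>(4 \<cdot> 2\<^sup>k)\<^sup>q\<close> to the integral. The hypothesis
  concerns finite sets of levels because the sums of energies are controlled for those; the passage
  to all integers runs through the enumeration \<^const>\<open>int_decode\<close>.
\<close>

lemma nn_integral_powr_le_of_layers:
  fixes v :: "'a \<Rightarrow> real"
  assumes [measurable]: "v \<in> borel_measurable M" and q: "0 < q"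
    and sums: "\<And>A. finite A \<Longrightarrow>
      (\<Sum>k\<in>A. emeasure M {x \<in> space M. 2 powr (real_of_int k + 1) \<le> v x} * ennreal ((2 powr k) powr q)) \<le> X"
  shows "(\<integral>\<^sup>+x. ennreal (max 0 (v x) powr q) \<partial>M) \<le> ennreal (4 powr q) * X"
proof -
  define E where "E k = {x \<in> space M. 2 powr (real_of_int k + 1) \<le> v x}" for k :: int
  define a where "a k = ennreal (4 powr q) * ennreal ((2 powr real_of_int k) powr q)" for k :: int
  have E [measurable]: "E k \<in> sets M" for k
    by (simp add: E_def)
  have "(\<integral>\<^sup>+x. ennreal (max 0 (v x) powr q) \<partial>M)
      \<le> (\<integral>\<^sup>+x. (\<Sum>i. a (int_decode i) * indicator (E (int_decode i)) x) \<partial>M)"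
  proof (rule nn_integral_mono)
    fix x assume x: "x \<in> space M"
    show "ennreal (max 0 (v x) powr q) \<le> (\<Sum>i. a (int_decode i) * indicator (E (int_decode i)) x)"
    proof (cases "0 < v x")
      case True
      \<comment> \<open>the level with \<open>2\<^sup>k\<^sup>+\<^sup>1 \<le> v x < 2\<^sup>k\<^sup>+\<^sup>2\<close>, hence the shift by one\<close>
      define k where "k = \<lfloor>log 2 (v x)\<rfloor> - 1"
      have k: "real_of_int k + 1 \<le> log 2 (v x)" "log 2 (v x) < real_of_int k + 2"
        by (simp_all add: k_def) linarith
      have lo: "2 powr (real_of_int k + 1) \<le> v x"
        using k(1) True by (simp add: powr_le_iff)
      have "v x \<le> 4 * 2 powr k"
        using k(2) True by (simp add: log_less_iff powr_add)
      then have "max 0 (v x) powr q \<le> (4 * 2 powr k) powr q"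
        using True q by (intro powr_mono2) auto
      then have "ennreal (max 0 (v x) powr q) \<le> a k * indicator (E k) x"
        using lo x by (auto simp: a_def E_def powr_mult simp flip: ennreal_mult intro!: ennreal_leI)
      also have "\<dots> = (\<Sum>i\<in>{int_encode k}. a (int_decode i) * indicator (E (int_decode i)) x)"
        by simp
      also have "\<dots> \<le> (\<Sum>i. a (int_decode i) * indicator (E (int_decode i)) x)"
        by (intro sum_le_suminf) auto
      finally show ?thesis .
    qed simp
  qed
  also have "\<dots> = (\<Sum>i. a (int_decode i) * emeasure M (E (int_decode i)))"
    by (subst nn_integral_suminf) (simp_all add: nn_integral_cmult_indicator)
  also have "\<dots> \<le> ennreal (4 powr q) * X"
  proof (rule suminf_le_const)
    fix N
    have "(\<Sum>i<N. a (int_decode i) * emeasure M (E (int_decode i)))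
        = (\<Sum>k\<in>int_decode ` {..<N}. a k * emeasure M (E k))"
      by (subst sum.reindex) (auto intro: inj_on_subset[OF inj_int_decode])
    also have "\<dots> = ennreal (4 powr q)
        * (\<Sum>k\<in>int_decode ` {..<N}. emeasure M (E k) * ennreal ((2 powr k) powr q))"
      by (simp add: a_def sum_distrib_left mult_ac)
    also have "\<dots> \<le> ennreal (4 powr q) * X"
      unfolding E_def by (intro mult_left_mono sums) auto
    finally show "(\<Sum>i<N. a (int_decode i) * emeasure M (E (int_decode i))) \<le> ennreal (4 powr q) * X" .
  qed simp
  finally show ?thesis .
qed

text \<open>
  The core of the truncation argument: the weak inequality is used once for each dyadic truncation of
  \<open>v\<close>. Factors \<open>2 \<cdot> 4\<^sup>q\<close> and \<open>4\<^sup>q\<close> come from the two preceding lemmas.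
\<close>

lemma positive_part_le_of_weak:
  fixes v :: "'a \<Rightarrow> real"
  assumes v [measurable]: "v \<in> borel_measurable M" and p: "0 < p" "p \<le> q" and C: "0 < C"
    and half: "emeasure M (space M) \<le> 2 * emeasure M {x \<in> space M. v x \<le> 0}"
    and weak: "\<And>w. w \<in> L_infinity M \<Longrightarrow>
      (INF a. weak_power M q (\<lambda>x. w x - a)) \<le> ennreal C * ennpowr (kernel_energy M \<kappa> p w) (q / p)"
  shows "(\<integral>\<^sup>+x. ennreal (max 0 (v x) powr q) \<partial>M)
    \<le> ennreal (2 * 16 powr q * dyadic_const p powr (q / p) * C) * ennpowr (kernel_energy M \<kappa> p v) (q / p)"
proof -
  define w where "w k x = dyadic_trunc k (v x)" for k x
  let ?E = "kernel_energy M \<kappa> p"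
  let ?c = "dyadic_const p"
  have c: "0 < ?c"
    using p(1) by (rule dyadic_const_pos)
  have w [measurable]: "w k \<in> borel_measurable M" for k
    unfolding w_def dyadic_trunc_def by measurable
  have bdd: "w k \<in> L_infinity M" for k
    unfolding L_infinity_def
    by (auto intro!: exI[of _ "2 powr k"] simp: w_def dyadic_trunc_def)
  have layer: "emeasure M {x \<in> space M. 2 powr (real_of_int k + 1) \<le> v x} * ennreal ((2 powr k) powr q)
      \<le> ennreal (2 * 4 powr q * C) * ennpowr (?E (w k)) (q / p)" for k :: int
  proof -
    have "emeasure M {x \<in> space M. v x \<le> 0} \<le> emeasure M {x \<in> space M. w k x = 0}"
      by (intro emeasure_mono)
         (auto simp: w_def dyadic_trunc_def max_absorb1 order_trans[OF _ powr_ge_zero])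
    then have half': "emeasure M (space M) \<le> 2 * emeasure M {x \<in> space M. w k x = 0}"
      using half by (meson mult_left_mono order_trans zero_le)
    have "emeasure M {x \<in> space M. 2 powr (real_of_int k + 1) \<le> v x} * ennreal ((2 powr k) powr q)
        \<le> emeasure M {x \<in> space M. 2 powr k \<le> w k x} * ennreal ((2 powr k) powr q)"
      by (intro mult_right_mono emeasure_mono) (auto simp: w_def dyadic_trunc_def powr_add)
    also have "\<dots> \<le> ennreal (2 * 4 powr q) * (INF a. weak_power M q (\<lambda>x. w k x - a))"
    proof (subst ennreal_cancel_left_le_iff[symmetric], simp, intro INF_greatest)
      fix a
      show "ennreal (1 / (2 * 4 powr q))
          * (emeasure M {x \<in> space M. 2 powr k \<le> w k x} * ennreal ((2 powr k) powr q))
          \<le> weak_power M q (\<lambda>x. w k x - a)"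
        by (subst ennreal_cancel_left_le_iff) (auto intro!: level_set_le_weak_power half')
    qed
    also have "\<dots> \<le> ennreal (2 * 4 powr q) * (ennreal C * ennpowr (?E (w k)) (q / p))"
      by (intro mult_left_mono weak bdd) simp
    finally show ?thesis
      using C by (simp add: ennreal_mult mult_ac)
  qed
  have "(\<integral>\<^sup>+x. ennreal (max 0 (v x) powr q) \<partial>M)
      \<le> ennreal (4 powr q) * (ennreal (2 * 4 powr q * C * ?c powr (q / p)) * ennpowr (?E v) (q / p))"
  proof (rule nn_integral_powr_le_of_layers)
    fix A :: "int set" assume A: "finite A"
    have "(\<Sum>k\<in>A. emeasure M {x \<in> space M. 2 powr (real_of_int k + 1) \<le> v x} * ennreal ((2 powr k) powr q))
        \<le> ennreal (2 * 4 powr q * C) * (\<Sum>k\<in>A. ennpowr (?E (w k)) (q / p))"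
      unfolding sum_distrib_left by (intro sum_mono layer)
    also have "\<dots> \<le> ennreal (2 * 4 powr q * C) * ennpowr (\<Sum>k\<in>A. ?E (w k)) (q / p)"
      using A p by (intro mult_left_mono sum_ennpowr_le) auto
    also have "\<dots> \<le> ennreal (2 * 4 powr q * C) * ennpowr (ennreal ?c * ?E v) (q / p)"
      using A p c by (intro mult_left_mono ennpowr_mono sum_kernel_energy_le)
        (auto simp: w_def intro: sum_dyadic_trunc_le)
    also have "\<dots> = ennreal (2 * 4 powr q * C * ?c powr (q / p)) * ennpowr (?E v) (q / p)"
      using c C by (simp add: ennpowr_cmult ennreal_mult mult_ac)
    finally show "(\<Sum>k\<in>A. emeasure M {x \<in> space M. 2 powr (real_of_int k + 1) \<le> v x}
        * ennreal ((2 powr k) powr q))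
      \<le> ennreal (2 * 4 powr q * C * ?c powr (q / p)) * ennpowr (?E v) (q / p)" .
  qed (use p in auto)
  also have "\<dots> = ennreal (2 * 16 powr q * ?c powr (q / p) * C) * ennpowr (?E v) (q / p)"
  proof -
    have "(16::real) powr q = 4 powr q * 4 powr q"
      by (simp flip: powr_mult)
    then have "2 * 16 powr q * ?c powr (q / p) * C = 4 powr q * (2 * 4 powr q * C * ?c powr (q / p))"
      by simp
    then show ?thesis
      using C by (simp only: mult.assoc[symmetric] ennreal_mult[symmetric] mult_nonneg_nonneg
        powr_ge_zero zero_le_numeral less_imp_le)
  qed
  finally show ?thesis .
qed

text \<open>
  At a median \<open>b\<close> both \<open>u - b\<close> and \<open>b - u\<close> are nonpositive on half of the space, and they have the
  same energy as \<open>u\<close>; adding the two bounds doubles the constant.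
\<close>

lemma (in finite_measure) strong_of_weak:
  assumes u [measurable]: "u \<in> borel_measurable M" and p: "0 < p" "p \<le> q" and C: "0 < C"
    and weak: "\<And>w. w \<in> L_infinity M \<Longrightarrow>
      (INF a. weak_power M q (\<lambda>x. w x - a)) \<le> ennreal C * ennpowr (kernel_energy M \<kappa> p w) (q / p)"
  shows "(INF a. \<integral>\<^sup>+x. ennreal (\<bar>u x - a\<bar> powr q) \<partial>M)
    \<le> ennreal (4 * 16 powr q * dyadic_const p powr (q / p) * C) * ennpowr (kernel_energy M \<kappa> p u) (q / p)"
proof -
  let ?K = "2 * 16 powr q * dyadic_const p powr (q / p) * C"
  let ?X = "ennreal ?K * ennpowr (kernel_energy M \<kappa> p u) (q / p)"
  obtain b where b: "measure M (space M) \<le> 2 * measure M {x \<in> space M. u x \<le> b}"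
    "measure M (space M) \<le> 2 * measure M {x \<in> space M. b \<le> u x}"
    using median_exists[OF u] by blast
  have to_ennreal: "emeasure M (space M) \<le> 2 * emeasure M S"
    if "measure M (space M) \<le> 2 * measure M S" for S
    using ennreal_leI[OF that] by (simp add: emeasure_eq_measure ennreal_mult)
  have energy: "kernel_energy M \<kappa> p (\<lambda>x. u x - b) = kernel_energy M \<kappa> p u"
    "kernel_energy M \<kappa> p (\<lambda>x. b - u x) = kernel_energy M \<kappa> p u"
    by (simp_all add: kernel_energy_def abs_minus_commute)
  have up: "(\<integral>\<^sup>+x. ennreal (max 0 (u x - b) powr q) \<partial>M) \<le> ?X"
    using positive_part_le_of_weak[OF _ p C _ weak, where v = "\<lambda>x. u x - b"] to_ennreal[OF b(1)]
    by (simp add: energy)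
  have down: "(\<integral>\<^sup>+x. ennreal (max 0 (b - u x) powr q) \<partial>M) \<le> ?X"
    using positive_part_le_of_weak[OF _ p C _ weak, where v = "\<lambda>x. b - u x"] to_ennreal[OF b(2)]
    by (simp add: energy)
  have "(INF a. \<integral>\<^sup>+x. ennreal (\<bar>u x - a\<bar> powr q) \<partial>M) \<le> (\<integral>\<^sup>+x. ennreal (\<bar>u x - b\<bar> powr q) \<partial>M)"
    by (rule INF_lower) simp
  also have "\<dots> = (\<integral>\<^sup>+x. ennreal (max 0 (u x - b) powr q) + ennreal (max 0 (b - u x) powr q) \<partial>M)"
    by (intro nn_integral_cong) (simp add: max_def abs_if)
  also have "\<dots> = (\<integral>\<^sup>+x. ennreal (max 0 (u x - b) powr q) \<partial>M) + (\<integral>\<^sup>+x. ennreal (max 0 (b - u x) powr q) \<partial>M)"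
    by (rule nn_integral_add) simp_all
  also have "\<dots> \<le> ?X + ?X"
    by (rule add_mono[OF up down])
  also have "\<dots> = ennreal (?K + ?K) * ennpowr (kernel_energy M \<kappa> p u) (q / p)"
    using C by (subst ennreal_plus) (auto simp: distrib_right)
  also have "?K + ?K = 4 * 16 powr q * dyadic_const p powr (q / p) * C"
    by simp
  finally show ?thesis .
qed

section \<open>Equivalence of the two inequalities\<close>

lemma integrable_L_infinity:
  assumes "finite_measure M" "u \<in> L_infinity M"
  shows "integrable M u"
  using assms by (auto simp: L_infinity_def intro!: finite_measure.integrable_const_bound)

theorem theorem4p1:
  fixes p q :: real
  assumes "0 < p" and "p \<le> q"
  shows "\<exists>K::real. 0 < K \<and>
    (\<forall>(n::nat) (G :: (nat \<Rightarrow> real) set) (\<mu> :: (nat \<Rightarrow> real) measure) (\<delta>::real) (\<tau>::ennreal).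
       2 \<le> n \<longrightarrow> openin (Euclidean_space n) G \<longrightarrow> borel_measure_on G \<mu> \<longrightarrow>
       emeasure \<mu> G < \<infinity> \<longrightarrow> 0 < \<delta> \<longrightarrow> \<delta> < 1 \<longrightarrow> 0 < \<tau> \<longrightarrow>
         ((\<exists>C1>0. weak_ineq n G \<mu> \<delta> \<tau> p q C1) \<longleftrightarrow> (\<exists>C2>0. strong_ineq n G \<mu> \<delta> \<tau> p q C2)) \<and>
         (\<forall>C1>0. weak_ineq n G \<mu> \<delta> \<tau> p q C1 \<longrightarrow> strong_ineq n G \<mu> \<delta> \<tau> p q (K * C1)) \<and>
         (\<forall>C2>0. strong_ineq n G \<mu> \<delta> \<tau> p q C2 \<longrightarrow> weak_ineq n G \<mu> \<delta> \<tau> p q C2))"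
proof -
  define K where "K = 4 * 16 powr q * dyadic_const p powr (q / p)"
  have K: "0 < K"
    using dyadic_const_pos[OF assms(1)] by (simp add: K_def)
  have step: "((\<exists>C1>0. weak_ineq n G \<mu> \<delta> \<tau> p q C1) \<longleftrightarrow> (\<exists>C2>0. strong_ineq n G \<mu> \<delta> \<tau> p q C2)) \<and>
      (\<forall>C1>0. weak_ineq n G \<mu> \<delta> \<tau> p q C1 \<longrightarrow> strong_ineq n G \<mu> \<delta> \<tau> p q (K * C1)) \<and>
      (\<forall>C2>0. strong_ineq n G \<mu> \<delta> \<tau> p q C2 \<longrightarrow> weak_ineq n G \<mu> \<delta> \<tau> p q C2)"
    if borel: "borel_measure_on G \<mu>" and finite: "emeasure \<mu> G < \<infinity>" for n G \<mu> \<delta> \<tau>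
  proof -
    have G: "space \<mu> = G"
      using sets_eq_imp_space_eq[of \<mu> "restrict_space borel G"] borel
      by (simp add: borel_measure_on_def space_restrict_space)
    interpret finite_measure \<mu>
      using finite G by (intro finite_measureI) auto
    obtain \<kappa> where energy: "frac_energy n G \<mu> \<delta> \<tau> p = kernel_energy \<mu> \<kappa> p"
      using frac_energy_eq_kernel_energy[OF G] by blast
    have weak_iff: "weak_ineq n G \<mu> \<delta> \<tau> p q C \<longleftrightarrow> (\<forall>u\<in>L_infinity \<mu>.
        (INF a. weak_power \<mu> q (\<lambda>x. u x - a)) \<le> ennreal C * ennpowr (kernel_energy \<mu> \<kappa> p u) (q / p))" for C
      by (simp add: weak_ineq_def weak_power_def energy G)
    have strong_iff: "strong_ineq n G \<mu> \<delta> \<tau> p q C \<longleftrightarrow> (\<forall>u. integrable \<mu> u \<longrightarrow>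
        (INF a. \<integral>\<^sup>+x. ennreal (\<bar>u x - a\<bar> powr q) \<partial>\<mu>) \<le> ennreal C * ennpowr (kernel_energy \<mu> \<kappa> p u) (q / p))" for C
    proof -
      have "(\<integral>\<^sup>+x\<in>G. ennreal (\<bar>u x - a\<bar> powr q) \<partial>\<mu>) = (\<integral>\<^sup>+x. ennreal (\<bar>u x - a\<bar> powr q) \<partial>\<mu>)" for u a
        by (intro nn_integral_cong) (simp add: G)
      then show ?thesis
        by (simp add: strong_ineq_def energy)
    qed
    have to_strong: "strong_ineq n G \<mu> \<delta> \<tau> p q (K * C)" if "0 < C" "weak_ineq n G \<mu> \<delta> \<tau> p q C" for C
      unfolding strong_iff K_def
      using that assms strong_of_weak[of _ p q C \<kappa>] by (auto simp: weak_iff)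
    have to_weak: "weak_ineq n G \<mu> \<delta> \<tau> p q C" if strong: "strong_ineq n G \<mu> \<delta> \<tau> p q C" for C
      unfolding weak_iff
    proof
      fix u assume "u \<in> L_infinity \<mu>"
      then have u: "integrable \<mu> u"
        by (rule integrable_L_infinity[OF finite_measure_axioms])
      then have [measurable]: "u \<in> borel_measurable \<mu>"
        by simp
      have "(INF a. weak_power \<mu> q (\<lambda>x. u x - a)) \<le> (INF a. \<integral>\<^sup>+x. ennreal (\<bar>u x - a\<bar> powr q) \<partial>\<mu>)"
        using assms by (intro INF_mono' weak_power_le_nn_integral) auto
      also have "\<dots> \<le> ennreal C * ennpowr (kernel_energy \<mu> \<kappa> p u) (q / p)"
        using strong u by (simp add: strong_iff)
      finally show "(INF a. weak_power \<mu> q (\<lambda>x. u x - a)) \<le> ennreal C * ennpowr (kernel_energy \<mu> \<kappa> p u) (q / p)" .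
    qed
    show ?thesis
      using to_strong to_weak K by (blast intro: mult_pos_pos)
  qed
  show ?thesis
    using K step by (intro exI[of _ K]) blast
qed

end
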